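(* Let $\pi\in\mathrm{NC}(n)$ and $1\leq i\leq n-1$. Then $$s_i\cdot F_\pi=\begin{cases}-F_{s_i(\pi)} & \text{if } s_i(\pi)\text{ is noncrossing}\\ F_{\sigma(s_i(\pi))} & \text{otherwise}\end{cases}\qquad\text{and}\qquad s_i\cdot f_\pi=\begin{cases}-f_{s_i(\pi)} & \text{if } s_i(\pi)\text{ is noncrossing}\\ f_{\sigma(s_i(\pi))} & \text{otherwise.}\end{cases}$$
   Context: Set partitions. $\Pi(n)$ is the set of all set partitions of $[n]$; $\mathrm{NC}(n)$ is the set of noncrossing ones (whenever $a<b<c<d$ with $a,c$ in the same block and $b,d$ in the same block, all four are in the same block). For $w\in\mathfrak{S}_n$, $w(\pi)$ is the set partition with blocks $w(B)$, $B$ a block of $\pi$; $s_i=(i,i+1)$. Fermions. $\wedge\{\Theta_n,\Xi_n\}$ is the exterior algebra over $\mathbb{C}$ on anticommuting generators $\theta_1,\dots,\theta_n,\xi_1,\dots,\xi_n$, with $\mathfrak{S}_n$ acting by algebra automorphisms $w\cdot\theta_i=\theta_{w(i)}$, $w\cdot\xi_i=\xi_{w(i)}$. For a generator $\omega$, contraction $\omega\odot(-)$ is the linear operator sending a product $\omega_1\cdots\omega_r$ of distinct generators to $(-1)^{s-1}\omega_1\cdots\widehat{\omega_s}\cdots\omega_r$ if $\omega=\omega_s$ and to $0$ if $\omega\notin\{\omega_1,\dots,\omega_r\}$; extend linearly in the first argument to linear combinations of generators. For nonempty $B\subseteq[n]$, $\rho_B(f)=\sum_{i,j\in B,\ i\neq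 j}\xi_i\cdot(\theta_j\odot f)$ if $|B|>1$ and $\rho_B(f)=\xi_i\cdot(\theta_i\odot f)$ if $B=\{i\}$. These operators commute pairwise. For $\pi=\{B_1/\cdots/B_k\}\in\Pi(n)$, $F_\pi=(\rho_{B_1}\circ\cdots\circ\rho_{B_k})(\theta_1\cdots\theta_n)$ and $f_\pi=(\xi_1+\cdots+\xi_n)\odot F_\pi$. Skein expressions. For $\mu\in\Pi(n)$ not noncrossing with $s_i(\mu)$ noncrossing, the indices $i,i+1$ lie in different blocks $B_i\ni i$, $B_{i+1}\ni i+1$ of $\mu$, both of size at least 2. Let $\mu_1,\dots,\mu_4$ be obtained from $\mu$ by replacing the pair $B_i,B_{i+1}$ by the pair: $(B_i-\{i\})\cup\{i+1\}$ and $(B_{i+1}-\{i+1\})\cup\{i\}$ for $\mu_1$; $(B_i\cup B_{i+1})-\{i,i+1\}$ and $\{i,i+1\}$ for $\mu_2$; $B_i-\{i\}$ and $B_{i+1}\cup\{i\}$ for $\mu_3$; $B_{i+1}-\{i+1\}$ and $B_i\cup\{i+1\}$ for $\mu_4$. Define $F_{\sigma(\mu)}$ to be $F_{\mu_1}+F_{\mu_2}$ if $|B_i|=|B_{i+1}|=2$; $F_{\mu_1}+F_{\mu_2}-F_{\mu_3}$ if $|B_i|>2,|B_{i+1}|=2$; $F_{\mu_1}+F_{\mu_2}-F_{\mu_4}$ if $|B_i|=2,|B_{i+1}|>2$; $F_{\mu_1}+F_{\mu_2}-F_{\mu_3}-F_{\mu_4}$ if $|B_i|,|B_{i+1}|>2$.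 Define $f_{\sigma(\mu)}$ by the same formulas with $f$ in place of $F$. In the claim this is applied to $\mu=s_i(\pi)$ with the same index $i$. *)

theory Defs
  imports Complex_Main "HOL-Library.Disjoint_Sets" "HOL-Combinatorics.Transposition"
begin

section \<open>The exterior algebra on the generators theta i and xi i\<close>

datatype generator = Theta nat | Xi nat

text \<open>
  The order of the generators (all thetas before all xis) only serves to fix the sign of the
  basis monomials below.
\<close>

instantiation generator :: linorder
begin

fun less_eq_generator :: "generator \<Rightarrow> generator \<Rightarrow> bool" where
  "less_eq_generator (Theta i) (Theta j) \<longleftrightarrow> i \<le> j"
| "less_eq_generator (Theta i) (Xi j) \<longleftrightarrow> True"
| "less_eq_generator (Xi i) (Theta j) \<longleftrightarrow> False"
| "less_eq_generator (Xi i) (Xi j) \<longleftrightarrow> i \<le> j"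

definition less_generator :: "generator \<Rightarrow> generator \<Rightarrow> bool" where
  "less_generator g h \<longleftrightarrow> g \<le> h \<and> \<not> h \<le> g"

instance
proof
  fix x y z :: generator
  show "(x < y) = (x \<le> y \<and> \<not> y \<le> x)" by (rule less_generator_def)
  show "x \<le> x" by (cases x) auto
  show "x \<le> y \<Longrightarrow> y \<le> z \<Longrightarrow> x \<le> z" by (cases x; cases y; cases z) auto
  show "x \<le> y \<Longrightarrow> y \<le> x \<Longrightarrow> x = y" by (cases x; cases y) auto
  show "x \<le> y \<or> y \<le> x" by (cases x; cases y) auto
qed

end

text \<open>
  An element of the exterior algebra is given by its coordinates with respect to the basis of
  monomials: the finite set \<open>S\<close> stands for the product of the elements of \<open>S\<close> in increasing
  order (see \<open>monom_eq_prod\<close>).  All generators \<open>\<theta>\<^sub>i, \<xi>\<^sub>i\<close> with \<open>i\<close> a natural number are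
  available; the algebra on \<open>\<theta>\<^sub>1, \<dots>, \<theta>\<^sub>n, \<xi>\<^sub>1, \<dots>, \<xi>\<^sub>n\<close> is the subalgebra of the elements supported
  on sets of generators with indices in \<open>{1..n}\<close>.
\<close>

typedef fermion =
  "{f :: generator set \<Rightarrow> complex. finite {S. f S \<noteq> 0} \<and> (\<forall>S. f S \<noteq> 0 \<longrightarrow> finite S)}"
  morphisms coord Abs_fermion
  by (rule exI[of _ "\<lambda>_. 0"]) simp

setup_lifting type_definition_fermion

lemma finite_supp [simp]: "finite {S. coord x S \<noteq> 0}"
  and coord_finite: "coord x S \<noteq> 0 \<Longrightarrow> finite S"
  using coord[of x] by auto

lemma coord_infinite [simp]: "infinite S \<Longrightarrow> coord x S = 0"
  using coord_finite by blast

lemma fermion_eqI: "(\<And>S. finite S \<Longrightarrow> coord x S = coord y S) \<Longrightarrow> x = y"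
  by (metis coord_infinite coord_inject ext)

text \<open>
  \<open>shuffle_sign S T\<close> is the sign of the permutation sorting the increasing list of \<open>S\<close> followed
  by that of \<open>T\<close>.
\<close>

definition shuffle_sign :: "generator set \<Rightarrow> generator set \<Rightarrow> complex" where
  "shuffle_sign S T = (-1) ^ card {(s, t). s \<in> S \<and> t \<in> T \<and> t < s}"

instantiation fermion :: "{ab_group_add, one, times}"
begin

lift_definition zero_fermion :: fermion is "\<lambda>_. 0" by simp

lift_definition plus_fermion :: "fermion \<Rightarrow> fermion \<Rightarrow> fermion" is "\<lambda>f g S. f S + g S"
proof -
  fix f g :: "generator set \<Rightarrow> complex"
  assume "finite {S. f S \<noteq> 0} \<and> (\<forall>S. f S \<noteq> 0 \<longrightarrow> finite S)"
    "finite {S. g S \<noteq> 0} \<and> (\<forall>S. g S \<noteq> 0 \<longrightarrow> finite S)"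
  moreover have "{S. f S + g S \<noteq> 0} \<subseteq> {S. f S \<noteq> 0} \<union> {S. g S \<noteq> 0}" by auto
  ultimately show "finite {S. f S + g S \<noteq> 0} \<and> (\<forall>S. f S + g S \<noteq> 0 \<longrightarrow> finite S)"
    by (metis (no_types, lifting) add.right_neutral finite_Un finite_subset)
qed

lift_definition uminus_fermion :: "fermion \<Rightarrow> fermion" is "\<lambda>f S. - f S" by simp

definition minus_fermion :: "fermion \<Rightarrow> fermion \<Rightarrow> fermion" where
  "minus_fermion x y = x + - y"

lift_definition one_fermion :: fermion is "\<lambda>S. if S = {} then 1 else 0" by simp

lift_definition times_fermion :: "fermion \<Rightarrow> fermion \<Rightarrow> fermion" is
  "\<lambda>f g U. if finite U then \<Sum>S\<in>Pow U. shuffle_sign S (U - S) * f S * g (U - S) else 0"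
proof -
  fix f g :: "generator set \<Rightarrow> complex"
  let ?h = "\<lambda>U. if finite U then \<Sum>S\<in>Pow U. shuffle_sign S (U - S) * f S * g (U - S) else 0"
  assume "finite {S. f S \<noteq> 0} \<and> (\<forall>S. f S \<noteq> 0 \<longrightarrow> finite S)"
    "finite {S. g S \<noteq> 0} \<and> (\<forall>S. g S \<noteq> 0 \<longrightarrow> finite S)"
  hence "finite ((\<lambda>(S, T). S \<union> T) ` ({S. f S \<noteq> 0} \<times> {S. g S \<noteq> 0}))" by blast
  moreover have "{U. ?h U \<noteq> 0} \<subseteq> (\<lambda>(S, T). S \<union> T) ` ({S. f S \<noteq> 0} \<times> {S. g S \<noteq> 0})"
  proof
    fix U assume "U \<in> {U. ?h U \<noteq> 0}"
    hence "(\<Sum>S\<in>Pow U. shuffle_sign S (U - S) * f S * g (U - S)) \<noteq> 0" by (auto split: if_splits)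
    then obtain S where "S \<in> Pow U" "f S \<noteq> 0" "g (U - S) \<noteq> 0"
      by (metis (no_types, lifting) mult_eq_0_iff sum.neutral)
    moreover from this have "U = S \<union> (U - S)" by blast
    ultimately show "U \<in> (\<lambda>(S, T). S \<union> T) ` ({S. f S \<noteq> 0} \<times> {S. g S \<noteq> 0})"
      by (intro image_eqI[of _ _ "(S, U - S)"]) auto
  qed
  ultimately show "finite {U. ?h U \<noteq> 0} \<and> (\<forall>U. ?h U \<noteq> 0 \<longrightarrow> finite U)"
    by (auto intro: finite_subset split: if_splits)
qed

instance
proof
  fix a b c :: fermion
  show "a + b + c = a + (b + c)" by transfer (simp add: algebra_simps)
  show "a + b = b + a" by transfer (simp add: algebra_simps)
  show "0 + a = a" by transfer simp
  show "- a + a = 0" by transfer simp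
  show "a - b = a + - b" by (rule minus_fermion_def)
qed

end

lemma coord_simps [simp]:
  "coord 0 S = 0" "coord (x + y) S = coord x S + coord y S" "coord (- x) S = - coord x S"
  "coord (x - y) S = coord x S - coord y S" "coord 1 S = (if S = {} then 1 else 0)"
  by (simp_all add: zero_fermion.rep_eq plus_fermion.rep_eq uminus_fermion.rep_eq
      one_fermion.rep_eq minus_fermion_def del: add_uminus_conv_diff)

lemma coord_sum [simp]: "coord (sum f A) S = (\<Sum>a\<in>A. coord (f a) S)"
  by (induction A rule: infinite_finite_induct) auto

lemma coord_times:
  "finite U \<Longrightarrow> coord (x * y) U = (\<Sum>S\<in>Pow U. shuffle_sign S (U - S) * coord x S * coord y (U - S))"
  by (simp add: times_fermion.rep_eq)

lemma shuffle_sign_empty [simp]: "shuffle_sign {} T = 1" "shuffle_sign S {} = 1"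
  by (simp_all add: shuffle_sign_def)

lemma finite_inversions:
  fixes S T :: "generator set"
  assumes "finite S" "finite T"
  shows "finite {(s, t). s \<in> S \<and> t \<in> T \<and> t < s}"
proof (rule finite_subset)
  show "{(s, t). s \<in> S \<and> t \<in> T \<and> t < s} \<subseteq> S \<times> T" by blast
  show "finite (S \<times> T)" using assms by (rule finite_cartesian_product)
qed

lemma shuffle_sign_Un_left:
  assumes "finite S" "finite S'" "finite T" "S \<inter> S' = {}"
  shows "shuffle_sign (S \<union> S') T = shuffle_sign S T * shuffle_sign S' T"
proof -
  let ?A = "{(s, t). s \<in> S \<and> t \<in> T \<and> t < s}" and ?B = "{(s, t). s \<in> S' \<and> t \<in> T \<and> t < s}"
  have "{(s, t). s \<in> S \<union> S' \<and> t \<in> T \<and> t < s} = ?A \<union> ?B" by auto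
  moreover have "finite ?A" "finite ?B" by (rule finite_inversions; use assms in simp)+
  moreover have "?A \<inter> ?B = {}" using assms by blast
  ultimately show ?thesis
    by (simp only: shuffle_sign_def card_Un_disjoint power_add)
qed

lemma shuffle_sign_Un_right:
  assumes "finite S" "finite T" "finite T'" "T \<inter> T' = {}"
  shows "shuffle_sign S (T \<union> T') = shuffle_sign S T * shuffle_sign S T'"
proof -
  let ?A = "{(s, t). s \<in> S \<and> t \<in> T \<and> t < s}" and ?B = "{(s, t). s \<in> S \<and> t \<in> T' \<and> t < s}"
  have "{(s, t). s \<in> S \<and> t \<in> T \<union> T' \<and> t < s} = ?A \<union> ?B" by auto
  moreover have "finite ?A" "finite ?B" by (rule finite_inversions; use assms in simp)+
  moreover have "?A \<inter> ?B = {}" using assms by blast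
  ultimately show ?thesis
    by (simp only: shuffle_sign_def card_Un_disjoint power_add)
qed

instance fermion :: ring_1
proof
  fix a b c :: fermion
  show "a * b * c = a * (b * c)"
  proof (rule fermion_eqI)
    fix U :: "generator set" assume U: "finite U"
    let ?k = shuffle_sign
    let ?l = "\<lambda>(S, R). ?k S (U - S) * (?k R (S - R) * coord a R * coord b (S - R)) * coord c (U - S)"
    let ?r = "\<lambda>(R, T). ?k R (U - R) * coord a R * (?k T (U - R - T) * coord b T * coord c (U - R - T))"
    have fin: "finite S" if "S \<subseteq> U" for S using that U finite_subset by blast
    have "coord (a * b * c) U = (\<Sum>S\<in>Pow U. ?k S (U - S) * coord (a * b) S * coord c (U - S))"
      by (rule coord_times[OF U])
    also have "\<dots> = (\<Sum>S\<in>Pow U. \<Sum>R\<in>Pow S. ?l (S, R))"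
    proof (rule sum.cong[OF refl])
      fix S assume "S \<in> Pow U"
      hence "finite S" using fin by blast
      thus "?k S (U - S) * coord (a * b) S * coord c (U - S) = (\<Sum>R\<in>Pow S. ?l (S, R))"
        by (simp only: coord_times sum_distrib_left sum_distrib_right prod.case)
    qed
    also have "\<dots> = sum ?l (Sigma (Pow U) Pow)"
      by (subst sum.Sigma) (use U fin in auto)
    also have "\<dots> = sum ?r (Sigma (Pow U) (\<lambda>R. Pow (U - R)))"
    proof (rule sum.reindex_bij_witness[of _ "\<lambda>(R, T). (R \<union> T, R)" "\<lambda>(S, R). (R, S - R)"], goal_cases)
      case (5 p)
      obtain S R where p: "p = (S, R)" by (cases p)
      with 5 have S: "S \<subseteq> U" "R \<subseteq> S" by auto
      have e: "U - R - (S - R) = U - S" "U - R = (S - R) \<union> (U - S)" using S by auto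
      have f: "finite R" "finite (S - R)" "finite (U - S)" using S fin U by auto
      have "?k (R \<union> (S - R)) (U - S) = ?k R (U - S) * ?k (S - R) (U - S)"
        by (rule shuffle_sign_Un_left) (use f in auto)
      moreover have "R \<union> (S - R) = S" using S by auto
      ultimately have k1: "?k S (U - S) = ?k R (U - S) * ?k (S - R) (U - S)" by (simp only:)
      have k2: "?k R (U - R) = ?k R (S - R) * ?k R (U - S)"
        unfolding e(2) by (rule shuffle_sign_Un_right) (use f in auto)
      show ?case by (simp only: p e(1) k1 k2 prod.case mult_ac)
    qed auto
    also have "\<dots> = (\<Sum>R\<in>Pow U. \<Sum>T\<in>Pow (U - R). ?r (R, T))"
      by (subst sum.Sigma) (use U in auto)
    also have "\<dots> = (\<Sum>R\<in>Pow U. ?k R (U - R) * coord a R * coord (b * c) (U - R))"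
      using U by (simp only: coord_times sum_distrib_left prod.case finite_Diff)
    also have "\<dots> = coord (a * (b * c)) U"
      by (rule coord_times[OF U, symmetric])
    finally show "coord (a * b * c) U = coord (a * (b * c)) U" .
  qed
  show "1 * a = a"
  proof (rule fermion_eqI)
    fix U :: "generator set" assume U: "finite U"
    have "coord (1 * a) U = (\<Sum>S\<in>Pow U. if S = {} then coord a U else 0)"
      unfolding coord_times[OF U] by (rule sum.cong) auto
    thus "coord (1 * a) U = coord a U" using U by (simp add: sum.delta)
  qed
  show "a * 1 = a"
  proof (rule fermion_eqI)
    fix U :: "generator set" assume U: "finite U"
    have "coord (a * 1) U = (\<Sum>S\<in>Pow U. if S = U then coord a U else 0)"
      unfolding coord_times[OF U] by (rule sum.cong) auto
    thus "coord (a * 1) U = coord a U" using U by (simp add: sum.delta)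
  qed
  show "(a + b) * c = a * c + b * c"
    by (rule fermion_eqI) (simp add: coord_times algebra_simps sum.distrib)
  show "a * (b + c) = a * b + a * c"
    by (rule fermion_eqI) (simp add: coord_times algebra_simps sum.distrib)
  show "(0 :: fermion) \<noteq> 1"
    by (metis coord_simps(1,5) zero_neq_one)
qed

lift_definition scale :: "complex \<Rightarrow> fermion \<Rightarrow> fermion" is "\<lambda>c f S. c * f S"
  by (auto intro: rev_finite_subset)

lemma coord_scale [simp]: "coord (scale c x) S = c * coord x S"
  by transfer simp

interpretation fermion: vector_space scale
  by standard (auto intro!: fermion_eqI simp: algebra_simps)

lemma scale_mult [simp]: "scale c x * y = scale c (x * y)" "x * scale c y = scale c (x * y)"
  by (auto intro!: fermion_eqI simp: coord_times sum_distrib_left algebra_simps)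

lift_definition monom :: "generator set \<Rightarrow> fermion" is "\<lambda>S T. if finite S \<and> T = S then 1 else 0"
  by auto

lemma coord_monom: "coord (monom S) T = (if finite S \<and> T = S then 1 else 0)"
  by transfer simp

definition gen :: "generator \<Rightarrow> fermion" where
  "gen g = monom {g}"

abbreviation theta :: "nat \<Rightarrow> fermion" where "theta i \<equiv> gen (Theta i)"
abbreviation xi :: "nat \<Rightarrow> fermion" where "xi i \<equiv> gen (Xi i)"

text \<open>The linear map sending each basis monomial \<open>monom S\<close> to \<open>\<phi> S\<close>.\<close>

definition lin_ext :: "(generator set \<Rightarrow> fermion) \<Rightarrow> fermion \<Rightarrow> fermion" where
  "lin_ext \<phi> x = (\<Sum>S | coord x S \<noteq> 0. scale (coord x S) (\<phi> S))"

lemma lin_ext_superset: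
  assumes "finite A" "{S. coord x S \<noteq> 0} \<subseteq> A"
  shows "lin_ext \<phi> x = (\<Sum>S\<in>A. scale (coord x S) (\<phi> S))"
  unfolding lin_ext_def by (rule sum.mono_neutral_left) (use assms in auto)

lemma lin_ext_add: "lin_ext \<phi> (x + y) = lin_ext \<phi> x + lin_ext \<phi> y"
proof -
  let ?A = "{S. coord x S \<noteq> 0} \<union> {S. coord y S \<noteq> 0}"
  have "lin_ext \<phi> z = (\<Sum>S\<in>?A. scale (coord z S) (\<phi> S))" if "z \<in> {x, y, x + y}" for z
    by (rule lin_ext_superset) (use that in auto)
  thus ?thesis by (simp add: fermion.scale_left_distrib sum.distrib)
qed

lemma lin_ext_scale: "lin_ext \<phi> (scale c x) = scale c (lin_ext \<phi> x)"
  by (subst lin_ext_superset[of "{S. coord x S \<noteq> 0}"])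
     (auto simp: lin_ext_def fermion.scale_sum_right)

lemma lin_ext_monom [simp]: "finite S \<Longrightarrow> lin_ext \<phi> (monom S) = \<phi> S"
  by (subst lin_ext_superset[of "{S}"]) (auto simp: coord_monom)

lemma lin_ext_0 [simp]: "lin_ext \<phi> 0 = 0"
  by (simp add: lin_ext_def)

lemma lin_ext_sum: "lin_ext \<phi> (sum f A) = (\<Sum>a\<in>A. lin_ext \<phi> (f a))"
  by (induction A rule: infinite_finite_induct) (auto simp: lin_ext_add)

lemma fermion_expand: "x = (\<Sum>S | coord x S \<noteq> 0. scale (coord x S) (monom S))"
proof (rule fermion_eqI)
  fix T :: "generator set" assume "finite T"
  have "coord (\<Sum>S | coord x S \<noteq> 0. scale (coord x S) (monom S)) T
      = (\<Sum>S | coord x S \<noteq> 0. if T = S then coord x S else 0)"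
    unfolding coord_sum
    by (rule sum.cong) (auto simp: coord_monom coord_finite)
  also have "\<dots> = coord x T" by (subst sum.delta') auto
  finally show "coord x T = coord (\<Sum>S | coord x S \<noteq> 0. scale (coord x S) (monom S)) T" by simp
qed

lemma fermion_induct [case_names zero add scale monom]:
  assumes "P 0" "\<And>x y. P x \<Longrightarrow> P y \<Longrightarrow> P (x + y)" "\<And>c x. P x \<Longrightarrow> P (scale c x)"
    "\<And>S. finite S \<Longrightarrow> P (monom S)"
  shows "P x"
proof -
  have "P (\<Sum>S\<in>A. scale (coord x S) (monom S))" if "finite A" "A \<subseteq> {S. coord x S \<noteq> 0}" for A
    using that by (induction A rule: finite_induct) (auto intro!: assms intro: coord_finite)
  from this[of "{S. coord x S \<noteq> 0}"] show ?thesis using fermion_expand[of x] by simp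
qed

lemma monom_mult:
  assumes "finite S" "finite T"
  shows "monom S * monom T = (if S \<inter> T = {} then scale (shuffle_sign S T) (monom (S \<union> T)) else 0)"
proof (rule fermion_eqI)
  fix U :: "generator set" assume U: "finite U"
  have "coord (monom S * monom T) U =
      (\<Sum>R\<in>Pow U. if R = S then (if S \<subseteq> U \<and> U - S = T then shuffle_sign S T else 0) else 0)"
    unfolding coord_times[OF U] by (rule sum.cong) (use assms in \<open>auto simp: coord_monom\<close>)
  also have "\<dots> = (if S \<subseteq> U \<and> U - S = T then shuffle_sign S T else 0)"
    using U by (auto simp: sum.delta)
  also have "\<dots> = coord (if S \<inter> T = {} then scale (shuffle_sign S T) (monom (S \<union> T)) else 0) U"
    using assms by (auto simp: coord_monom)
  finally show "coord (monom S * monom T) U =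
    coord (if S \<inter> T = {} then scale (shuffle_sign S T) (monom (S \<union> T)) else 0) U" .
qed

definition pos_sign :: "generator \<Rightarrow> generator set \<Rightarrow> complex" where
  "pos_sign g S = (-1) ^ card {h \<in> S. h < g}"

lemma pos_sign_square [simp]: "pos_sign g S * pos_sign g S = 1"
  by (simp add: pos_sign_def flip: power_add mult_2)

lemma shuffle_sign_singleton: "shuffle_sign {g} S = pos_sign g S"
proof -
  have "{(s, t). s \<in> {g} \<and> t \<in> S \<and> t < s} = Pair g ` {h \<in> S. h < g}" by auto
  thus ?thesis by (simp add: shuffle_sign_def pos_sign_def card_image inj_on_def)
qed

lemma pos_sign_insert:
  "finite S \<Longrightarrow> h \<notin> S \<Longrightarrow> pos_sign g (insert h S) = (if h < g then - pos_sign g S else pos_sign g S)"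
proof -
  assume "finite S" "h \<notin> S"
  moreover have "{x \<in> insert h S. x < g} = (if h < g then insert h {x \<in> S. x < g} else {x \<in> S. x < g})"
    by auto
  ultimately show ?thesis by (simp add: pos_sign_def)
qed

lemma gen_mult_monom:
  "finite S \<Longrightarrow> gen g * monom S = (if g \<in> S then 0 else scale (pos_sign g S) (monom (insert g S)))"
  by (auto simp: gen_def monom_mult shuffle_sign_singleton)

lemma monom_empty: "monom {} = 1"
  by (rule fermion_eqI) (auto simp: coord_monom)

lemma gen_square [simp]: "gen g * gen g = 0"
  using gen_mult_monom[of "{g}" g] by (simp add: gen_def)

lemma gen_anticommute: "gen g * gen h = - (gen h * gen g)"
proof (cases "g = h")
  case False
  thus ?thesis
    using gen_mult_monom[of "{h}" g] gen_mult_monom[of "{g}" h]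
      pos_sign_insert[of "{}" h g] pos_sign_insert[of "{}" g h]
    by (cases g h rule: linorder_cases)
       (auto simp: gen_def insert_commute pos_sign_def)
qed simp

lemma gen_anticommute_left: "gen g * (gen h * x) = - (gen h * (gen g * x))"
  by (metis gen_anticommute mult.assoc mult_minus_left)

lemma monom_Cons:
  assumes "finite S" "\<And>h. h \<in> S \<Longrightarrow> g < h"
  shows "monom (insert g S) = gen g * monom S"
proof -
  have "g \<notin> S" "{h \<in> S. h < g} = {}" using assms(2) by fastforce+
  hence "g \<notin> S" "pos_sign g S = 1" by (simp_all only: pos_sign_def card.empty power_0 not_False_eq_True)
  thus ?thesis using assms(1) by (simp add: gen_mult_monom)
qed

lemma monom_eq_prod_aux:
  "sorted_wrt (<) xs \<Longrightarrow> monom (set xs) = prod_list (map gen xs)"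
  by (induction xs) (auto simp: monom_empty monom_Cons)

lemma monom_eq_prod: "finite S \<Longrightarrow> monom S = prod_list (map gen (sorted_list_of_set S))"
  using monom_eq_prod_aux[of "sorted_list_of_set S"] by simp

section \<open>The action of permutations\<close>

fun gen_act :: "(nat \<Rightarrow> nat) \<Rightarrow> generator \<Rightarrow> generator" where
  "gen_act w (Theta i) = Theta (w i)"
| "gen_act w (Xi i) = Xi (w i)"

definition perm_act :: "(nat \<Rightarrow> nat) \<Rightarrow> fermion \<Rightarrow> fermion" where
  "perm_act w = lin_ext (\<lambda>S. prod_list (map (\<lambda>g. gen (gen_act w g)) (sorted_list_of_set S)))"

lemma prod_insort:
  fixes \<psi> :: "generator \<Rightarrow> generator"
  assumes "sorted_wrt (<) xs"
  shows "gen (\<psi> g) * prod_list (map (\<lambda>h. gen (\<psi> h)) xs) =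
    (if g \<in> set xs then 0
     else scale (pos_sign g (set xs)) (prod_list (map (\<lambda>h. gen (\<psi> h)) (insort g xs))))"
  using assms
proof (induction xs)
  case Nil
  show ?case by (simp add: pos_sign_def)
next
  case (Cons x xs)
  let ?P = "\<lambda>xs. prod_list (map (\<lambda>h. gen (\<psi> h)) xs)"
  have x: "x \<notin> set xs" using Cons.prems by auto
  consider "g = x" | "g < x" | "x < g" by fastforce
  thus ?case
  proof cases
    case 1
    thus ?thesis by (simp flip: mult.assoc)
  next
    case 2
    hence "g \<notin> set (x # xs)" "{h \<in> set (x # xs). h < g} = {}" using Cons.prems by fastforce+
    hence "g \<notin> set (x # xs)" "pos_sign g (set (x # xs)) = 1"
      by (simp_all only: pos_sign_def card.empty power_0 not_False_eq_True)
    thus ?thesis using 2 by (simp add: less_imp_le)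
  next
    case 3
    have "gen (\<psi> g) * ?P (x # xs) = - (gen (\<psi> x) * (gen (\<psi> g) * ?P xs))"
      by (simp add: gen_anticommute_left[of "\<psi> g"])
    thus ?thesis using 3 Cons x by (auto simp: pos_sign_insert)
  qed
qed

lemma perm_act_gen_mult: "perm_act w (gen g * x) = gen (gen_act w g) * perm_act w x"
proof (induction x rule: fermion_induct)
  case (monom S)
  have s: "sorted_wrt (<) (sorted_list_of_set S)" by simp
  from monom prod_insort[OF s, of "gen_act w" g] show ?case
    by (simp add: perm_act_def gen_mult_monom lin_ext_scale)
qed (simp_all add: perm_act_def lin_ext_add lin_ext_scale distrib_left)

lemma perm_act_1 [simp]: "perm_act w 1 = 1"
  by (simp add: perm_act_def flip: monom_empty)

lemma perm_act_gen: "perm_act w (gen g) = gen (gen_act w g)"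
  using perm_act_gen_mult[of w g 1] by simp

lemma perm_act_linear:
  "perm_act w (x + y) = perm_act w x + perm_act w y" "perm_act w (scale c x) = scale c (perm_act w x)"
  by (simp_all add: perm_act_def lin_ext_add lin_ext_scale)

lemma perm_act_mult: "perm_act w (x * y) = perm_act w x * perm_act w y"
proof (induction x rule: fermion_induct)
  case (monom S)
  have "perm_act w (prod_list (map gen xs) * y) = perm_act w (prod_list (map gen xs)) * perm_act w y" for xs
    by (induction xs) (simp_all add: perm_act_gen_mult mult.assoc)
  thus ?case using monom by (simp add: monom_eq_prod)
qed (simp_all add: perm_act_linear distrib_right, simp add: perm_act_def)

section \<open>Contraction\<close>

definition contract_gen :: "generator \<Rightarrow> fermion \<Rightarrow> fermion" where
  "contract_gen g = lin_ext (\<lambda>S. if g \<in> S then scale (pos_sign g S) (monom (S - {g})) else 0)"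

text \<open>
  The first argument of \<open>contract\<close> is meant to be a linear combination of generators; only its
  part of degree 1 is used.
\<close>

definition contract :: "fermion \<Rightarrow> fermion \<Rightarrow> fermion" where
  "contract v x = (\<Sum>g | coord v {g} \<noteq> 0. scale (coord v {g}) (contract_gen g x))"

lemma contract_gen_linear:
  "contract_gen g (x + y) = contract_gen g x + contract_gen g y"
  "contract_gen g (scale c x) = scale c (contract_gen g x)"
  "contract_gen g 0 = 0"
  by (simp_all add: contract_gen_def lin_ext_add lin_ext_scale)

lemma contract_gen_minus: "contract_gen g (- x) = - contract_gen g x"
  using contract_gen_linear(2)[of g "-1" x] by simp

lemma contract_gen_sum: "contract_gen g (sum f A) = (\<Sum>a\<in>A. contract_gen g (f a))"
  by (simp add: contract_gen_def lin_ext_sum)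

lemma contract_of_gen [simp]: "contract (gen g) x = contract_gen g x"
proof -
  have "{h. coord (gen g) {h} \<noteq> 0} = {g}" by (auto simp: gen_def coord_monom)
  thus ?thesis by (simp add: contract_def) (simp add: gen_def coord_monom)
qed

lemma finite_degree1: "finite {g. coord v {g} \<noteq> 0}"
  using finite_vimageI[OF finite_supp[of v], of "\<lambda>g. {g}"] by (simp add: inj_on_def vimage_def)

lemma contract_superset:
  assumes "finite A" "{g. coord v {g} \<noteq> 0} \<subseteq> A"
  shows "contract v x = (\<Sum>g\<in>A. scale (coord v {g}) (contract_gen g x))"
  unfolding contract_def by (rule sum.mono_neutral_left) (use assms in auto)

lemma contract_linear_left:
  "contract (u + v) x = contract u x + contract v x" "contract (scale c v) x = scale c (contract v x)"
proof -
  let ?A = "{g. coord u {g} \<noteq> 0} \<union> {g. coord v {g} \<noteq> 0}"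
  have *: "contract z x = (\<Sum>g\<in>?A. scale (coord z {g}) (contract_gen g x))" if "z \<in> {u, v, u + v}" for z
    by (rule contract_superset) (use that finite_degree1 in auto)
  show "contract (u + v) x = contract u x + contract v x"
    by (simp add: * fermion.scale_left_distrib sum.distrib)
  show "contract (scale c v) x = scale c (contract v x)"
    by (subst contract_superset[of "{g. coord v {g} \<noteq> 0}"])
       (auto simp: contract_def fermion.scale_sum_right finite_degree1)
qed

lemma contract_gen_mult:
  "contract_gen g (gen h * x) = (if g = h then x else 0) - gen h * contract_gen g x"
proof (induction x rule: fermion_induct)
  case (monom S)
  have ins: "pos_sign k (insert l T) = (if l < k then - pos_sign k T else pos_sign k T)"
    if "finite T" "l \<notin> T" for k l T using pos_sign_insert that .
  show ?case
  proof (cases "h \<in> S")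
    case True
    have "pos_sign h (S - {h}) = pos_sign h S"
      using ins[of "S - {h}" h h] True monom by (simp add: insert_absorb)
    moreover have "insert h (S - {h}) = S" using True by blast
    moreover have "contract_gen g (gen h * monom S) = 0"
      using True monom by (simp add: contract_gen_def gen_mult_monom)
    ultimately show ?thesis using True monom
      by (cases "g = h") (simp_all add: contract_gen_def gen_mult_monom)
  next
    case h: False
    show ?thesis
    proof (cases "g = h")
      case True
      thus ?thesis using h monom ins[of S h h]
        by (auto simp: contract_gen_def gen_mult_monom lin_ext_scale)
    next
      case gh: False
      show ?thesis
      proof (cases "g \<in> S")
        case True
        have 1: "pos_sign h S = (if g < h then - pos_sign h (S - {g}) else pos_sign h (S - {g}))"
          using ins[of "S - {g}" g h] True monom by (simp add: insert_absorb)
        have 2: "pos_sign g (insert h S) = (if h < g then - pos_sign g S else pos_sign g S)"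
          using ins[of S h g] h monom by simp
        have 3: "insert h S - {g} = insert h (S - {g})" using gh by auto
        have 4: "pos_sign h S * pos_sign g (insert h S) = - (pos_sign g S * pos_sign h (S - {g}))"
        proof (cases "g < h")
          case True
          hence "\<not> h < g" by simp
          with True show ?thesis unfolding 1 2 by simp
        next
          case False
          hence "h < g" using gh by simp
          with False show ?thesis unfolding 1 2 by simp
        qed
        have "contract_gen g (gen h * monom S) =
            scale (pos_sign h S * pos_sign g (insert h S)) (monom (insert h (S - {g})))"
          using h True monom by (simp add: contract_gen_def gen_mult_monom lin_ext_scale 3)
        also have "\<dots> = - (gen h * contract_gen g (monom S))"
          unfolding 4 using h gh True monom by (simp add: contract_gen_def gen_mult_monom)
        finally show ?thesis using gh by simp
      qed (use gh h monom in \<open>auto simp: contract_gen_def gen_mult_monom lin_ext_scale\<close>)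
    qed
  qed
next
  case (add x y)
  thus ?case by (auto simp: contract_gen_linear distrib_left)
next
  case (scale c x)
  thus ?case by (auto simp: contract_gen_linear fermion.scale_right_diff_distrib)
qed (simp add: contract_gen_linear)

lemma contract_gen_1 [simp]: "contract_gen g 1 = 0"
  by (simp add: contract_gen_def flip: monom_empty)

text \<open>Contraction on a product of distinct generators (in an arbitrary order, counted from 0).\<close>

lemma contract_gen_prod_list:
  assumes "distinct gs" "s < length gs"
  shows "contract_gen (gs ! s) (prod_list (map gen gs)) =
    scale ((-1) ^ s) (prod_list (map gen (take s gs @ drop (Suc s) gs)))"
proof -
  have notin: "contract_gen g (prod_list (map gen gs)) = 0" if "g \<notin> set gs" for g gs
    using that by (induction gs) (auto simp: contract_gen_mult)
  show ?thesis using assms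
  proof (induction gs arbitrary: s)
    case (Cons h gs)
    show ?case
    proof (cases s)
      case 0
      thus ?thesis using Cons.prems by (simp add: contract_gen_mult notin)
    next
      case (Suc t)
      hence "gs ! t \<noteq> h" using Cons.prems by auto
      thus ?thesis using Suc Cons by (simp add: contract_gen_mult mult.assoc)
    qed
  qed simp
qed

lemma contract_gen_prod_list_notin:
  "g \<notin> set gs \<Longrightarrow> contract_gen g (prod_list (map gen gs)) = 0"
  by (induction gs) (auto simp: contract_gen_mult)

lemma contract_gen_anticommute: "contract_gen g (contract_gen h x) = - contract_gen h (contract_gen g x)"
proof (induction x rule: fermion_induct)
  case (monom S)
  have "contract_gen g (contract_gen h (prod_list (map gen xs))) =
      - contract_gen h (contract_gen g (prod_list (map gen xs)))" for xs
  proof (induction xs)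
    case (Cons a xs)
    have diff: "contract_gen k (x - y) = contract_gen k x - contract_gen k y" for k x y
      by (simp add: diff_conv_add_uminus contract_gen_linear contract_gen_minus del: add_uminus_conv_diff)
    show ?case using Cons by (auto simp: contract_gen_mult diff contract_gen_linear)
  qed (simp add: contract_gen_linear)
  thus ?case using monom by (simp add: monom_eq_prod)
qed (simp_all add: contract_gen_linear)

section \<open>Block operators and the elements attached to set partitions\<close>

definition rho :: "nat set \<Rightarrow> fermion \<Rightarrow> fermion" where
  "rho B x =
     (if card B > 1
      then \<Sum>(i, j)\<in>{(i, j). i \<in> B \<and> j \<in> B \<and> i \<noteq> j}. xi i * contract (theta j) x
      else let i = the_elem B in xi i * contract (theta i) x)"

text \<open>
  The block operators commute, so their composition over the finite set of blocks does not depend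
  on an order of the blocks and can be written with the library's fold over finite sets.
\<close>

lemma comp_fun_commute_rho: "comp_fun_commute rho"
proof
  define P where "P B = (if card B > 1 then {(i, j). i \<in> B \<and> j \<in> B \<and> i \<noteq> j}
    else {(the_elem B, the_elem B)})" for B :: "nat set"
  define D where "D p x = xi (fst p) * contract_gen (Theta (snd p)) x" for p x
  have rho: "rho B x = (\<Sum>p\<in>P B. D p x)" for B x
    by (simp add: rho_def P_def D_def Let_def case_prod_unfold)
  have Dsum: "D p (sum f A) = (\<Sum>a\<in>A. D p (f a))" for p f and A :: "(nat \<times> nat) set"
    by (simp add: D_def contract_gen_sum sum_distrib_left)
  have comm: "D p (D q x) = D q (D p x)" for p q x
    using gen_anticommute_left[of "Xi (fst p)" "Xi (fst q)"]
      contract_gen_anticommute[of "Theta (snd p)" "Theta (snd q)" x]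
    by (simp add: D_def contract_gen_mult)
  show "rho C \<circ> rho B = rho B \<circ> rho C" for B C
  proof
    fix x
    have "rho C (rho B x) = (\<Sum>q\<in>P C. \<Sum>p\<in>P B. D q (D p x))" by (simp add: rho Dsum)
    also have "\<dots> = (\<Sum>p\<in>P B. \<Sum>q\<in>P C. D p (D q x))"
      by (subst sum.swap) (simp add: comm)
    also have "\<dots> = rho B (rho C x)" by (simp add: rho Dsum)
    finally show "(rho C \<circ> rho B) x = (rho B \<circ> rho C) x" by simp
  qed
qed

definition F_elt :: "nat \<Rightarrow> nat set set \<Rightarrow> fermion" where
  "F_elt n \<pi> = Finite_Set.fold rho (prod_list (map theta [1..<Suc n])) \<pi>"

definition f_elt :: "nat \<Rightarrow> nat set set \<Rightarrow> fermion" where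
  "f_elt n \<pi> = contract (\<Sum>j\<in>{1..n}. xi j) (F_elt n \<pi>)"

lemma F_elt_list:
  assumes "distinct Bs"
  shows "F_elt n (set Bs) = foldr rho Bs (prod_list (map theta [1..<Suc n]))"
proof -
  interpret comp_fun_commute rho by (rule comp_fun_commute_rho)
  show ?thesis using assms
    by (induction Bs) (simp_all add: F_elt_def)
qed

section \<open>Set partitions and skein expressions\<close>

definition set_partitions :: "nat \<Rightarrow> nat set set set" where
  "set_partitions n = {\<pi>. partition_on {1..n} \<pi>}"

definition NC :: "nat \<Rightarrow> nat set set set" where
  "NC n = {\<pi> \<in> set_partitions n.
     \<forall>a b c d. a < b \<and> b < c \<and> c < d \<and> (\<exists>B\<in>\<pi>. {a, c} \<subseteq> B) \<and> (\<exists>B\<in>\<pi>. {b, d} \<subseteq> B)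
       \<longrightarrow> (\<exists>B\<in>\<pi>. {a, b, c, d} \<subseteq> B)}"

definition part_act :: "(nat \<Rightarrow> nat) \<Rightarrow> nat set set \<Rightarrow> nat set set" where
  "part_act w \<pi> = (\<lambda>B. w ` B) ` \<pi>"

definition adj_swap :: "nat \<Rightarrow> nat \<Rightarrow> nat" where
  "adj_swap i = Transposition.transpose i (i + 1)"

definition block_of :: "nat set set \<Rightarrow> nat \<Rightarrow> nat set" where
  "block_of \<mu> i = (THE B. B \<in> \<mu> \<and> i \<in> B)"

definition replace_blocks :: "nat set set \<Rightarrow> nat \<Rightarrow> nat set \<Rightarrow> nat set \<Rightarrow> nat set set" where
  "replace_blocks \<mu> i C D = (\<mu> - {block_of \<mu> i, block_of \<mu> (i + 1)}) \<union> {C, D}"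

text \<open>
  \<open>skein G i \<mu>\<close> is \<open>G\<^bsub>\<sigma>(\<mu>)\<^esub>\<close> for \<open>G\<close> either of the families \<open>F\<close>, \<open>f\<close>.  It is only meaningful if \<open>\<mu>\<close>
  is crossing and \<open>s\<^sub>i(\<mu>)\<close> is noncrossing; then both blocks have at least two elements, and the last
  case is the one where both have more than two.
\<close>

definition skein :: "(nat set set \<Rightarrow> fermion) \<Rightarrow> nat \<Rightarrow> nat set set \<Rightarrow> fermion" where
  "skein G i \<mu> =
    (let B = block_of \<mu> i;
         B' = block_of \<mu> (i + 1);
         \<mu>1 = replace_blocks \<mu> i ((B - {i}) \<union> {i + 1}) ((B' - {i + 1}) \<union> {i});
         \<mu>2 = replace_blocks \<mu> i ((B \<union> B') - {i, i + 1}) {i, i + 1};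
         \<mu>3 = replace_blocks \<mu> i (B - {i}) (B' \<union> {i});
         \<mu>4 = replace_blocks \<mu> i (B' - {i + 1}) (B \<union> {i + 1})
     in if card B = 2 \<and> card B' = 2 then G \<mu>1 + G \<mu>2
        else if card B > 2 \<and> card B' = 2 then G \<mu>1 + G \<mu>2 - G \<mu>3
        else if card B = 2 \<and> card B' > 2 then G \<mu>1 + G \<mu>2 - G \<mu>4
        else G \<mu>1 + G \<mu>2 - G \<mu>3 - G \<mu>4)"

end

theory Submission
  imports Defs
begin

text \<open>
  Equivariance of the block operators and the antisymmetry of \<open>\<theta>\<^sub>1 \<cdots> \<theta>\<^sub>n\<close> give
  \<open>s\<^sub>i \<cdot> F\<^sub>\<pi> = - F\<^bsub>s\<^sub>i(\<pi>)\<^esub>\<close> for every set partition, so only the skein relation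
  \<open>F\<^sub>\<mu> + F\<^bsub>\<sigma>(\<mu>)\<^esub> = 0\<close> is left.  It holds already at the level of operators: put
  \<open>D\<^bsub>X,Y\<^esub> = (\<Sum>x\<in>X. \<xi>\<^sub>x) \<cdot> (\<Sum>y\<in>Y. \<theta>\<^sub>y \<odot> -)\<close>.  Then \<open>D\<^bsub>X,Y\<^esub> D\<^bsub>Z,W\<^esub> = - D\<^bsub>X,W\<^esub> D\<^bsub>Z,Y\<^esub>\<close>, and for blocks
  with at least two elements \<open>\<rho>\<^bsub>X \<union> Y\<^esub> = \<rho>\<^sub>X + \<rho>\<^sub>Y + D\<^bsub>X,Y\<^esub> + D\<^bsub>Y,X\<^esub>\<close>.  Reading \<open>\<rho>\<close> as 0 on singletons
  makes this valid for all blocks and also merges the four cases in the definition of \<open>\<sigma>(\<mu>)\<close>;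
  after expansion all terms cancel in pairs.
\<close>

section \<open>Equivariance\<close>

lemma perm_act_0 [simp]: "perm_act w 0 = 0"
  by (simp add: perm_act_def)

lemma perm_act_minus: "perm_act w (- x) = - perm_act w x"
  using perm_act_linear(2)[of w "-1" x] by simp

lemma perm_act_diff: "perm_act w (x - y) = perm_act w x - perm_act w y"
  using perm_act_linear(1)[of w x "- y"] by (simp add: perm_act_minus)

lemma perm_act_sum: "perm_act w (sum f A) = (\<Sum>a\<in>A. perm_act w (f a))"
  by (induction A rule: infinite_finite_induct) (auto simp: perm_act_linear)

lemma inj_gen_act: "inj w \<Longrightarrow> gen_act w g = gen_act w h \<longleftrightarrow> g = h"
  by (cases g; cases h) (auto dest: injD)

text \<open>Along a product of generators both sides satisfy the recursion
  \<open>contract_gen_mult\<close>; injectivity of \<open>w\<close> preserves its test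
  \<open>g = h\<close>.\<close>

lemma perm_act_contract_gen:
  assumes "inj w"
  shows "perm_act w (contract_gen g x) = contract_gen (gen_act w g) (perm_act w x)"
proof (induction x rule: fermion_induct)
  case (monom S)
  have "perm_act w (contract_gen g (prod_list (map gen xs))) =
      contract_gen (gen_act w g) (perm_act w (prod_list (map gen xs)))" for xs
    by (induction xs)
       (simp_all add: contract_gen_mult contract_gen_linear perm_act_gen_mult perm_act_diff
          inj_gen_act[OF assms])
  thus ?case using monom by (simp add: monom_eq_prod)
qed (simp_all add: perm_act_linear contract_gen_linear)

lemma perm_act_rho:
  assumes "inj w" "finite B" "B \<noteq> {}"
  shows "perm_act w (rho B x) = rho (w ` B) (perm_act w x)"
proof -
  have card: "card (w ` B) = card B"
    using assms by (simp add: card_image inj_on_subset)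
  show ?thesis
  proof (cases "card B > 1")
    case True
    have "perm_act w (rho B x) =
        (\<Sum>(i, j)\<in>{(i, j). i \<in> B \<and> j \<in> B \<and> i \<noteq> j}.
          xi (w i) * contract_gen (Theta (w j)) (perm_act w x))"
      using True
      by (simp add: rho_def perm_act_sum perm_act_gen_mult perm_act_contract_gen[OF assms(1)]
          case_prod_unfold)
    also have "\<dots> = (\<Sum>(i, j)\<in>{(i, j). i \<in> w ` B \<and> j \<in> w ` B \<and> i \<noteq> j}.
        xi i * contract_gen (Theta j) (perm_act w x))"
      by (rule sum.reindex_bij_witness[of _ "map_prod (inv w) (inv w)" "map_prod w w"])
         (use assms in \<open>auto simp: inj_eq\<close>)
    also have "\<dots> = rho (w ` B) (perm_act w x)"
      using True card by (simp add: rho_def)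
    finally show ?thesis .
  next
    case False
    hence "card B = 1"
      using assms by (metis One_nat_def Suc_lessI card_gt_0_iff)
    then obtain b where "B = {b}"
      by (auto simp: card_1_singleton_iff)
    thus ?thesis
      by (simp add: rho_def Let_def perm_act_gen_mult perm_act_contract_gen[OF assms(1)])
  qed
qed

text \<open>Injectivity of \<open>w\<close> keeps distinct blocks distinct, so no operator is lost
  in the fold over the image.\<close>

lemma perm_act_fold_rho:
  assumes "inj w" "finite \<pi>" "\<And>B. B \<in> \<pi> \<Longrightarrow> finite B \<and> B \<noteq> {}"
  shows "perm_act w (Finite_Set.fold rho x \<pi>) =
    Finite_Set.fold rho (perm_act w x) (part_act w \<pi>)"
proof -
  interpret comp_fun_commute rho by (rule comp_fun_commute_rho)
  show ?thesis using assms(2,3)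
  proof (induction \<pi> rule: finite_induct)
    case (insert B \<pi>)
    have "w ` B \<notin> part_act w \<pi>"
      using insert.hyps assms(1) by (auto simp: part_act_def inj_image_eq_iff)
    thus ?case
      using insert by (simp add: part_act_def perm_act_rho[OF assms(1)])
  qed (simp add: part_act_def)
qed

text \<open>Only the adjacent factors at \<open>i\<close> and \<open>i + 1\<close> are exchanged,
  and they anticommute.\<close>

lemma perm_act_theta_prod:
  assumes "1 \<le> i" "i < n"
  shows "perm_act (adj_swap i) (prod_list (map theta [1..<Suc n])) =
    - prod_list (map theta [1..<Suc n])"
proof -
  have split: "[1..<Suc n] = [1..<i] @ [i, Suc i] @ [Suc (Suc i)..<Suc n]"
  proof -
    have "[1..<Suc n] = [1..<i] @ [i..<Suc n]"
      using assms upt_add_eq_append[of 1 i "Suc n - i"] by simp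
    thus ?thesis
      using assms by (simp add: upt_conv_Cons del: upt_Suc)
  qed
  have fixed: "perm_act (adj_swap i) (prod_list (map theta xs)) = prod_list (map theta xs)"
    if "i \<notin> set xs" "Suc i \<notin> set xs" for xs
    using that
    by (induction xs) (auto simp: perm_act_gen_mult adj_swap_def transpose_def)
  show ?thesis
    unfolding split
    using gen_anticommute_left[of "Theta (Suc i)" "Theta i"]
      fixed[of "[1..<i]"] fixed[of "[Suc (Suc i)..<Suc n]"]
    by (simp add: perm_act_mult perm_act_gen adj_swap_def del: upt_Suc)
qed

lemma perm_act_F_elt:
  assumes "partition_on {1..n} \<pi>" "1 \<le> i" "i < n"
  shows "perm_act (adj_swap i) (F_elt n \<pi>) = - F_elt n (part_act (adj_swap i) \<pi>)"
proof -
  have fin: "finite \<pi>"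
    using assms(1) finite_elements by blast
  have blocks: "finite B \<and> B \<noteq> {}" if "B \<in> \<pi>" for B
    using assms(1) that
    by (metis finite_atLeastAtMost finite_subset partition_onD1 partition_onD3 Sup_upper)
  \<comment> \<open>The sign from the product of the thetas has to be pulled out through all block
    operators.\<close>
  have minus: "Finite_Set.fold rho (- x) \<pi>' = - Finite_Set.fold rho x \<pi>'" if "finite \<pi>'" for x \<pi>'
  proof -
    interpret comp_fun_commute rho by (rule comp_fun_commute_rho)
    have rho_minus: "rho B (- x) = - rho B x" for B x
      by (simp add: rho_def contract_gen_minus Let_def case_prod_unfold sum_negf)
    from that show ?thesis
      by (induction \<pi>' rule: finite_induct) (simp_all add: rho_minus)
  qed
  have "inj (adj_swap i)"
    by (simp add: adj_swap_def)
  thus ?thesis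
    using perm_act_fold_rho[OF _ fin blocks] perm_act_theta_prod[OF assms(2,3)] fin
    by (simp add: F_elt_def minus part_act_def del: upt_Suc)
qed

lemma contract_linear_right:
  "contract v (x + y) = contract v x + contract v y"
  "contract v (- x) = - contract v x"
  "contract v (x - y) = contract v x - contract v y"
proof -
  show add: "contract v (x + y) = contract v x + contract v y" for x y
    by (simp add: contract_def contract_gen_linear fermion.scale_right_distrib sum.distrib)
  show minus: "contract v (- x) = - contract v x" for x
    by (simp add: contract_def contract_gen_minus sum_negf)
  show "contract v (x - y) = contract v x - contract v y"
    using add[of x "- y"] by (simp add: minus)
qed

lemma contract_sum_left: "contract (sum f A) x = (\<Sum>a\<in>A. contract (f a) x)"
proof (induction A rule: infinite_finite_induct)
  case (insert a A)
  thus ?case by (simp add: contract_linear_left)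
qed (simp_all add: contract_def)

text \<open>\<open>adj_swap i\<close> permutes \<open>{1..n}\<close> and so fixes the sum of the
  \<open>xi j\<close>; contraction with that sum is therefore equivariant.\<close>

lemma perm_act_f_elt:
  assumes "partition_on {1..n} \<pi>" "1 \<le> i" "i < n"
  shows "perm_act (adj_swap i) (f_elt n \<pi>) = - f_elt n (part_act (adj_swap i) \<pi>)"
proof -
  let ?w = "adj_swap i"
  have inj: "inj ?w"
    by (simp add: adj_swap_def)
  have "perm_act ?w (contract (\<Sum>j\<in>{1..n}. xi j) x) =
      contract (\<Sum>j\<in>{1..n}. xi j) (perm_act ?w x)" for x
  proof -
    have "perm_act ?w (contract (\<Sum>j\<in>{1..n}. xi j) x) =
        (\<Sum>j\<in>{1..n}. contract_gen (Xi (?w j)) (perm_act ?w x))"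
      by (simp add: contract_sum_left perm_act_sum perm_act_contract_gen[OF inj])
    also have "\<dots> = (\<Sum>j\<in>{1..n}. contract_gen (Xi j) (perm_act ?w x))"
      by (rule sum.reindex_bij_witness[of _ ?w ?w])
         (use assms in \<open>auto simp: adj_swap_def transpose_def split: if_splits\<close>)
    finally show ?thesis by (simp add: contract_sum_left)
  qed
  thus ?thesis
    using perm_act_F_elt[OF assms] by (simp add: f_elt_def contract_linear_right)
qed

section \<open>The operator identity behind the skein relation\<close>

text \<open>The operator \<open>D\<close> with indices \<open>X\<close>, \<open>Y\<close> announced
  at the start, diagonal terms included where \<open>X\<close> and \<open>Y\<close> meet.\<close>

definition hop :: "nat set \<Rightarrow> nat set \<Rightarrow> fermion \<Rightarrow> fermion" where
  "hop X Y x = (\<Sum>i\<in>X. xi i) * (\<Sum>j\<in>Y. contract_gen (Theta j) x)"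

lemma contract_gen_Theta_xi_sum:
  "contract_gen (Theta j) ((\<Sum>i\<in>Z. xi i) * y) = - ((\<Sum>i\<in>Z. xi i) * contract_gen (Theta j) y)"
  by (simp add: sum_distrib_right contract_gen_sum contract_gen_mult sum_negf)

text \<open>Moving the outer contractions past the inner \<xi> sum costs one sign and collects all
  contractions on the right.\<close>

lemma hop_hop:
  "hop X Y (hop Z W x) = - ((\<Sum>i\<in>X. xi i) * ((\<Sum>i\<in>Z. xi i) *
    (\<Sum>j\<in>Y. \<Sum>k\<in>W. contract_gen (Theta j) (contract_gen (Theta k) x))))"
  by (simp add: hop_def contract_gen_Theta_xi_sum contract_gen_sum sum_negf flip: sum_distrib_left)

text \<open>By \<open>hop_hop\<close> the two compositions differ only in the order of anticommuting
  contractions.\<close>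

lemma hop_exchange: "hop X Y (hop Z W x) = - hop X W (hop Z Y x)"
proof -
  have "(\<Sum>j\<in>Y. \<Sum>k\<in>W. contract_gen (Theta j) (contract_gen (Theta k) x)) =
      (\<Sum>k\<in>W. \<Sum>j\<in>Y. - contract_gen (Theta k) (contract_gen (Theta j) x))"
    by (subst sum.swap) (simp flip: contract_gen_anticommute)
  thus ?thesis
    by (simp add: hop_hop sum_negf)
qed

text \<open>Exchanging the first indices and exchanging the second ones each cost a sign; the two
  signs cancel.\<close>

lemma hop_commute: "hop X Y (hop Z W x) = hop Z W (hop X Y x)"
proof -
  have "(\<Sum>i\<in>X. xi i) * ((\<Sum>i\<in>Z. xi i) * y) =
      - ((\<Sum>i\<in>Z. xi i) * ((\<Sum>i\<in>X. xi i) * y))" for y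
  proof -
    have expand: "(\<Sum>i\<in>X. xi i) * ((\<Sum>i\<in>Z. xi i) * y) = (\<Sum>i\<in>X. \<Sum>k\<in>Z. xi i * (xi k * y))"
      for X Z
      by (simp only: sum_distrib_right, simp only: sum_distrib_left)
    have "(\<Sum>i\<in>X. \<Sum>k\<in>Z. xi i * (xi k * y)) = (\<Sum>k\<in>Z. \<Sum>i\<in>X. - (xi k * (xi i * y)))"
      by (subst sum.swap) (simp flip: gen_anticommute_left)
    thus ?thesis
      by (simp add: expand sum_negf)
  qed
  hence "hop X Y (hop Z W x) = - hop Z Y (hop X W x)"
    by (simp add: hop_hop)
  also have "\<dots> = hop Z W (hop X Y x)"
    by (subst hop_exchange) simp
  finally show ?thesis .
qed

lemma hop_linear:
  "hop X Y (x + y) = hop X Y x + hop X Y y"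
  "hop X Y (x - y) = hop X Y x - hop X Y y"
  "hop X Y (sum f A) = (\<Sum>a\<in>A. hop X Y (f a))"
proof -
  show add: "hop X Y (x + y) = hop X Y x + hop X Y y" for x y
    by (simp add: hop_def contract_gen_linear sum.distrib distrib_left)
  have "hop X Y (- x) = - hop X Y x" for x
    by (simp add: hop_def contract_gen_minus sum_negf)
  thus "hop X Y (x - y) = hop X Y x - hop X Y y"
    using add[of x "- y"] by simp
  show "hop X Y (sum f A) = (\<Sum>a\<in>A. hop X Y (f a))"
  proof (induction A rule: infinite_finite_induct)
    case (insert a A)
    thus ?case by (simp add: add)
  qed (simp_all add: hop_def contract_gen_linear)
qed

lemma hop_Un_left: "finite X \<Longrightarrow> finite Y \<Longrightarrow> X \<inter> Y = {} \<Longrightarrow> hop (X \<union> Y) Z x = hop X Z x + hop Y Z x"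
  by (simp add: hop_def sum.union_disjoint distrib_right)

lemma hop_Un_right: "finite X \<Longrightarrow> finite Y \<Longrightarrow> X \<inter> Y = {} \<Longrightarrow> hop Z (X \<union> Y) x = hop Z X x + hop Z Y x"
  by (simp add: hop_def sum.union_disjoint distrib_left)

text \<open>The operator \<open>\<rho>\<close> read as 0 on singletons.\<close>

definition rho0 :: "nat set \<Rightarrow> fermion \<Rightarrow> fermion" where
  "rho0 B x = hop B B x - (\<Sum>b\<in>B. hop {b} {b} x)"

text \<open>\<open>hop B B\<close> sums over all of \<open>B \<times> B\<close>, and the terms
  subtracted in \<open>rho0\<close> are its diagonal.\<close>

lemma rho_eq_rho0:
  assumes "card B > 1"
  shows "rho B = rho0 B"
proof
  fix x
  have fin: "finite B" using assms card.infinite by fastforce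
  let ?h = "\<lambda>(i, j). xi i * contract_gen (Theta j) x"
  let ?O = "{(i, j). i \<in> B \<and> j \<in> B \<and> i \<noteq> j}" and ?D = "(\<lambda>b. (b, b)) ` B"
  have "B \<times> B = ?O \<union> ?D"
    by auto
  moreover have "finite ?O"
    by (rule finite_subset[of _ "B \<times> B"]) (use fin in auto)
  hence "sum ?h (?O \<union> ?D) = sum ?h ?O + sum ?h ?D"
    by (rule sum.union_disjoint) (use fin in auto)
  ultimately have "sum ?h (B \<times> B) = sum ?h ?O + sum ?h ?D"
    by simp
  moreover have "sum ?h (B \<times> B) = hop B B x"
    by (simp add: hop_def sum_product sum.cartesian_product)
  moreover have "sum ?h ?D = (\<Sum>b\<in>B. hop {b} {b} x)"
    by (subst sum.reindex) (auto simp: inj_on_def hop_def)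
  ultimately show "rho B x = rho0 B x"
    using assms by (simp add: rho_def rho0_def)
qed

lemma rho0_singleton: "card B = 1 \<Longrightarrow> rho0 B x = 0"
  by (auto simp: card_1_singleton_iff rho0_def)

lemma rho0_Un:
  assumes "finite X" "finite Y" "X \<inter> Y = {}"
  shows "rho0 (X \<union> Y) x = rho0 X x + rho0 Y x + hop X Y x + hop Y X x"
  using assms by (simp add: rho0_def hop_Un_left hop_Un_right sum.union_disjoint)

lemma rho0_linear: "rho0 B (x + y) = rho0 B x + rho0 B y"
  by (simp add: rho0_def hop_linear sum.distrib)

text \<open>\<open>rho0\<close> is a combination of hops, which commute. As a rewrite rule this
  moves every \<open>rho0\<close> inside the hops.\<close>

lemma rho0_hop: "rho0 B (hop X Y x) = hop X Y (rho0 B x)"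
  by (simp add: rho0_def hop_linear hop_commute[of _ _ X Y])

text \<open>With \<open>j = i + 1\<close>, the left side lists \<mu>, \<mu>1 and \<mu>2, the right
  side \<mu>3 and \<mu>4. After expansion the terms with a factor \<open>rho0 A\<close> or
  \<open>rho0 C\<close> agree on both sides, so the products of two hops on the left have to
  cancel.\<close>

lemma rho0_skein:
  assumes "finite A" "finite C" "A \<inter> C = {}" "i \<notin> A" "i \<notin> C" "j \<notin> A" "j \<notin> C" "i \<noteq> j"
  shows "rho0 (insert i A) (rho0 (insert j C) x) + rho0 (insert j A) (rho0 (insert i C) x)
      + rho0 (A \<union> C) (rho0 {i, j} x)
    = rho0 A (rho0 (C \<union> {i, j}) x) + rho0 (A \<union> {i, j}) (rho0 C x)"
proof -
  have 1: "rho0 (insert k B) y = rho0 B y + hop {k} B y + hop B {k} y" if "k \<notin> B" "finite B" for k B y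
    using rho0_Un[of "{k}" B] that by (simp add: rho0_singleton)
  have 2: "rho0 {i, j} y = hop {i} {j} y + hop {j} {i} y" for y
    using 1[of i "{j}"] assms by (simp add: rho0_singleton)
  have 3: "rho0 (B \<union> {i, j}) y = rho0 B y + rho0 {i, j} y
      + hop {i} B y + hop {j} B y + hop B {i} y + hop B {j} y"
    if "i \<notin> B" "j \<notin> B" "finite B" for B y
  proof -
    have "rho0 (B \<union> {i, j}) y =
        rho0 B y + rho0 {i, j} y + hop B {i, j} y + hop {i, j} B y"
      by (rule rho0_Un) (use that in auto)
    moreover have "hop {i, j} B y = hop {i} B y + hop {j} B y" "hop B {i, j} y = hop B {i} y + hop B {j} y"
      using hop_Un_left[of "{i}" "{j}"] hop_Un_right[of "{i}" "{j}"] assms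
      by (simp_all add: insert_commute)
    ultimately show ?thesis by (simp add: algebra_simps)
  qed
  have 4: "rho0 (A \<union> C) y = rho0 A y + rho0 C y + hop A C y + hop C A y" for y
    using rho0_Un assms by blast
  \<comment> \<open>There are twelve products of two hops; each of these six rules cancels one pair
    of them.\<close>
  have exchange:
    "hop {j} C (hop {i} A x) = - hop {i} C (hop {j} A x)"
    "hop C {j} (hop A {i} x) = - hop C {i} (hop A {j} x)"
    "hop {j} C (hop A {i} x) = - hop {j} {i} (hop A C x)"
    "hop C {j} (hop {i} A x) = - hop {i} {j} (hop C A x)"
    "hop {i} C (hop A {j} x) = - hop {i} {j} (hop A C x)"
    "hop C {i} (hop {j} A x) = - hop {j} {i} (hop C A x)"
    by (metis hop_exchange hop_commute)+
  show ?thesis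
    using assms
    by (simp add: 1 2 3 4 rho0_linear hop_linear rho0_hop exchange algebra_simps
        del: Un_insert_right)
qed

section \<open>The skein relation for set partitions\<close>

text \<open>The blocks other than \<open>B\<close> and \<open>B'\<close> contribute one common
  element \<open>y\<close>, to which \<open>rho0_skein\<close> is applied.\<close>

lemma skein_F_elt:
  assumes part: "partition_on {1..n} \<mu>"
    and B: "B \<in> \<mu>" "i \<in> B" "card B \<ge> 2" and B': "B' \<in> \<mu>" "i + 1 \<in> B'" "card B' \<ge> 2"
    and neq: "B \<noteq> B'"
  shows "skein (F_elt n) i \<mu> = - F_elt n \<mu>"
proof -
  define R where "R = \<mu> - {B, B'}"
  define y where "y = F_elt n R"
  define A where "A = B - {i}"
  define C where "C = B' - {i + 1}"
  have disj: "X \<inter> Y = {}" if "X \<in> \<mu>" "Y \<in> \<mu>" "X \<noteq> Y" for X Y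
    using partition_onD2[OF part] that by (auto simp: disjoint_def)
  have fin: "finite B" "finite B'" "finite R"
    using B B' finite_elements[OF _ part] by (auto simp: R_def intro: card_ge_0_finite)
  have "block_of \<mu> k = X" if "X \<in> \<mu>" "k \<in> X" for k X
    unfolding block_of_def using that disj by (intro the_equality) auto
  note block = this[OF B(1,2)] this[OF B'(1,2)]
  have BA: "B = insert i A" "B' = insert (i + 1) C" "finite A" "finite C" "i \<notin> A" "i + 1 \<notin> C"
    unfolding A_def C_def using fin B(2) B'(2) by blast+
  have AC: "A \<inter> C = {}" "i \<notin> C" "i + 1 \<notin> A"
    using disj[OF B(1) B'(1) neq] B B' by (auto simp: A_def C_def)
  have card: "card B = Suc (card A)" "card B' = Suc (card C)"
    using BA by simp_all
  have pos: "card A \<ge> 1" "card C \<ge> 1"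
    using card B B' by auto
  \<comment> \<open>The new blocks stay inside \<open>B \<union> B'\<close>, so they differ from
    each other and from the blocks in \<open>R\<close>; the fold applies exactly two further
    operators to \<open>y\<close>.\<close>
  have pair: "F_elt n (R \<union> {X, Y}) = rho0 X (rho0 Y y)"
    if "card X > 1" "card Y > 1" "X \<inter> Y = {}" "X \<union> Y \<subseteq> B \<union> B'" for X Y
  proof -
    interpret comp_fun_commute rho by (rule comp_fun_commute_rho)
    have "X \<noteq> {}" "Y \<noteq> {}" using that by auto
    moreover have "Z \<inter> (B \<union> B') = {}" if "Z \<in> R" for Z
      using that disj B B' by (auto simp: R_def)
    ultimately have "X \<noteq> Y" "X \<notin> R" "Y \<notin> R"
      using that by blast+
    hence "F_elt n (R \<union> {X, Y}) = rho X (rho Y y)"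
      using fin by (simp add: F_elt_def y_def)
    thus ?thesis
      using that by (simp add: rho_eq_rho0)
  qed
  have "\<mu> = R \<union> {B, B'}"
    using B B' by (auto simp: R_def)
  hence F0: "F_elt n \<mu> = rho0 (insert i A) (rho0 (insert (i + 1) C) y)"
    using pair[of B B'] B B' disj[OF B(1) B'(1) neq] BA by simp
  have F1: "F_elt n (R \<union> {insert (i + 1) A, insert i C}) =
      rho0 (insert (i + 1) A) (rho0 (insert i C) y)"
    by (rule pair) (use BA AC pos in auto)
  have F2: "F_elt n (R \<union> {A \<union> C, {i, i + 1}}) = rho0 (A \<union> C) (rho0 {i, i + 1} y)"
  proof (rule pair)
    show "card (A \<union> C) > 1" using BA AC pos by (simp add: card_Un_disjoint)
  qed (use BA AC in auto)
  have card2: "card (X \<union> {i, i + 1}) > 1" if "finite X" for X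
    using card_mono[of "X \<union> {i, i + 1}" "{i, i + 1}"] that by simp
  have F3: "F_elt n (R \<union> {A, C \<union> {i, i + 1}}) = rho0 A (rho0 (C \<union> {i, i + 1}) y)" if "card A > 1"
    by (rule pair) (use that BA AC card2 in auto)
  have F4: "F_elt n (R \<union> {C, A \<union> {i, i + 1}}) = rho0 (A \<union> {i, i + 1}) (rho0 C y)" if "card C > 1"
    by (subst insert_commute, rule pair) (use that BA AC card2 in auto)
  have sets: "A \<union> {i + 1} = insert (i + 1) A" "C \<union> {i} = insert i C"
    "(B \<union> B') - {i, i + 1} = A \<union> C" "B - {i} = A" "B' - {i + 1} = C"
    "B' \<union> {i} = C \<union> {i, i + 1}" "B \<union> {i + 1} = A \<union> {i, i + 1}"
    using BA AC by auto
  have rel: "F_elt n \<mu> + F_elt n (R \<union> {insert (i + 1) A, insert i C})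
      + F_elt n (R \<union> {A \<union> C, {i, i + 1}})
    = rho0 A (rho0 (C \<union> {i, i + 1}) y) + rho0 (A \<union> {i, i + 1}) (rho0 C y)"
    unfolding F0 F1 F2 by (rule rho0_skein) (use BA AC in auto)
  \<comment> \<open>Used for a singleton \<open>C\<close>, whose vanishing \<open>rho0\<close> is
    the inner operator.\<close>
  have r0: "rho0 X 0 = 0" for X
    using rho0_linear[of X 0 0] by simp
  \<comment> \<open>If \<open>A\<close> or \<open>C\<close> is a singleton, its \<open>rho0\<close>
    vanishes, just when the definition omits \<mu>3 or \<mu>4; so one formula covers all four
    cases.\<close>
  have skein: "skein (F_elt n) i \<mu> =
      F_elt n (R \<union> {insert (i + 1) A, insert i C}) + F_elt n (R \<union> {A \<union> C, {i, i + 1}})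
      - rho0 A (rho0 (C \<union> {i, i + 1}) y) - rho0 (A \<union> {i, i + 1}) (rho0 C y)"
  proof -
    consider "card A = 1" "card C = 1" | "card A > 1" "card C = 1"
      | "card A = 1" "card C > 1" | "card A > 1" "card C > 1"
      using pos by linarith
    thus ?thesis
      unfolding skein_def Let_def block replace_blocks_def R_def[symmetric] sets card
      by cases (use F3 F4 in \<open>simp_all add: rho0_singleton r0 del: Un_insert_right Un_insert_left\<close>)
  qed
  show ?thesis
    using rel unfolding skein by (simp add: algebra_simps eq_neg_iff_add_eq_0)
qed

lemma skein_f_elt: "skein (f_elt n) i \<mu> = contract (\<Sum>j\<in>{1..n}. xi j) (skein (F_elt n) i \<mu>)"
  by (simp add: skein_def Let_def f_elt_def contract_linear_right)

section \<open>Crossings created by an adjacent transposition\<close>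

lemma adj_swap_less: "x < y \<Longrightarrow> \<not> (x = i \<and> y = i + 1) \<Longrightarrow> adj_swap i x < adj_swap i y"
  by (auto simp: adj_swap_def transpose_def)

lemma partition_on_part_act:
  assumes "partition_on {1..n} \<pi>" "1 \<le> i" "i < n"
  shows "partition_on {1..n} (part_act (adj_swap i) \<pi>)"
proof -
  have "adj_swap i ` {1..n} = {1..n}"
    using assms by (simp add: adj_swap_def)
  \<comment> \<open>\<open>partition_on_inj_image\<close> removes the empty set from the image,
    where it does not occur.\<close>
  moreover have "part_act (adj_swap i) \<pi> - {{}} = part_act (adj_swap i) \<pi>"
    using partition_onD3[OF assms(1)] by (auto simp: part_act_def)
  ultimately show ?thesis
    using partition_on_inj_image[OF assms(1), of "adj_swap i"]
    by (simp add: part_act_def adj_swap_def)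
qed

text \<open>
  A crossing of \<open>s\<^sub>i(\<pi>)\<close> that does not use \<open>i\<close> and \<open>i + 1\<close> as two neighbours is moved by the order
  preserving \<open>s\<^sub>i\<close> to a crossing of \<open>\<pi>\<close>.
\<close>

lemma crossing_part_act:
  assumes \<pi>: "\<pi> \<in> NC n" and part: "partition_on {1..n} (part_act (adj_swap i) \<pi>)"
    and crossing: "part_act (adj_swap i) \<pi> \<notin> NC n"
  obtains B B' where "B \<in> part_act (adj_swap i) \<pi>" "i \<in> B" "card B \<ge> 2"
    "B' \<in> part_act (adj_swap i) \<pi>" "i + 1 \<in> B'" "card B' \<ge> 2" "B \<noteq> B'"
proof -
  let ?w = "adj_swap i" and ?\<mu> = "part_act (adj_swap i) \<pi>"
  have ww: "?w ` ?w ` X = X" for X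
    by (simp add: adj_swap_def image_image)
  have preimage: "?w ` X \<in> \<pi>" if "X \<in> ?\<mu>" for X
    using that ww by (auto simp: part_act_def)
  have unique: "X = Y" if "X \<in> \<pi>" "Y \<in> \<pi>" "x \<in> X" "x \<in> Y" for X Y x
  proof -
    have "disjoint \<pi>"
      using \<pi> partition_onD2 by (auto simp: NC_def set_partitions_def)
    thus ?thesis using that by (auto simp: disjoint_def)
  qed
  obtain a b c d P Q where less: "a < b" "b < c" "c < d" and P: "P \<in> ?\<mu>" "a \<in> P" "c \<in> P"
    and Q: "Q \<in> ?\<mu>" "b \<in> Q" "d \<in> Q" and "\<not> (\<exists>B\<in>?\<mu>. {a, b, c, d} \<subseteq> B)"
  proof -
    have "?\<mu> \<in> set_partitions n"
      using part by (simp add: set_partitions_def)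
    with crossing obtain a b c d where "a < b" "b < c" "c < d" "\<exists>B\<in>?\<mu>. {a, c} \<subseteq> B"
      "\<exists>B\<in>?\<mu>. {b, d} \<subseteq> B" "\<not> (\<exists>B\<in>?\<mu>. {a, b, c, d} \<subseteq> B)"
      unfolding NC_def mem_Collect_eq by metis
    thus ?thesis using that by (metis insert_subset)
  qed
  hence neq: "P \<noteq> Q" by blast
  have "?w a \<in> ?w ` P" "?w c \<in> ?w ` P" "?w b \<in> ?w ` Q" "?w d \<in> ?w ` Q"
    using P Q by blast+
  moreover have "?w ` P \<noteq> ?w ` Q"
    using neq ww by metis
  ultimately have "\<not> (\<exists>X\<in>\<pi>. {?w a, ?w b, ?w c, ?w d} \<subseteq> X)"
    using preimage[OF P(1)] preimage[OF Q(1)] unique by (metis insert_subset)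
  moreover have "\<exists>X\<in>\<pi>. {?w a, ?w c} \<subseteq> X" "\<exists>X\<in>\<pi>. {?w b, ?w d} \<subseteq> X"
    using preimage[OF P(1)] preimage[OF Q(1)] P Q by (meson empty_subsetI imageI insert_subset)+
  \<comment> \<open>Otherwise the images would form a crossing of \<pi>.\<close>
  ultimately have "\<not> (?w a < ?w b \<and> ?w b < ?w c \<and> ?w c < ?w d)"
    using \<pi> unfolding NC_def mem_Collect_eq by metis
  hence "(a = i \<and> b = i + 1) \<or> (b = i \<and> c = i + 1) \<or> (c = i \<and> d = i + 1)"
    using less adj_swap_less by blast
  moreover have "card X \<ge> 2" if "X \<in> ?\<mu>" "x \<in> X" "y \<in> X" "x < y" for X x y
  proof -
    have "finite X"
      using part that by (metis Sup_upper finite_atLeastAtMost finite_subset partition_onD1)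
    thus ?thesis
      using card_mono[of X "{x, y}"] that by simp
  qed
  hence "card P \<ge> 2" "card Q \<ge> 2"
    using P Q less by (meson less_trans)+
  \<comment> \<open>Neighbours among \<open>a\<close>, \<open>b\<close>, \<open>c\<close>,
    \<open>d\<close> alternate between \<open>P\<close> and \<open>Q\<close>, so \<open>i\<close>
    and \<open>i + 1\<close> lie in different blocks.\<close>
  ultimately show ?thesis
    using that P Q neq by blast
qed

theorem theorem4p4:
  fixes n i :: nat and \<pi> :: "nat set set"
  assumes "\<pi> \<in> NC n" and "1 \<le> i" and "i \<le> n - 1"
  shows "perm_act (adj_swap i) (F_elt n \<pi>) =
           (if part_act (adj_swap i) \<pi> \<in> NC n
            then - F_elt n (part_act (adj_swap i) \<pi>)
            else skein (F_elt n) i (part_act (adj_swap i) \<pi>))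
       \<and> perm_act (adj_swap i) (f_elt n \<pi>) =
           (if part_act (adj_swap i) \<pi> \<in> NC n
            then - f_elt n (part_act (adj_swap i) \<pi>)
            else skein (f_elt n) i (part_act (adj_swap i) \<pi>))"
proof -
  let ?\<mu> = "part_act (adj_swap i) \<pi>"
  \<comment> \<open>The subtraction in \<open>n - 1\<close> is truncated, but
    \<open>1 \<le> i\<close> forces \<open>n\<close> to be positive.\<close>
  have n: "i < n" using assms by simp
  have \<pi>: "partition_on {1..n} \<pi>"
    using assms(1) by (simp add: NC_def set_partitions_def)
  have \<mu>: "partition_on {1..n} ?\<mu>"
    using partition_on_part_act[OF \<pi> assms(2) n] .
  \<comment> \<open>In the crossing case the skein expression is the negated element, so both
    branches ask for the value that equivariance supplies.\<close>
  have "skein (F_elt n) i ?\<mu> = - F_elt n ?\<mu>" if "?\<mu> \<notin> NC n"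
    using crossing_part_act[OF assms(1) \<mu> that] skein_F_elt[OF \<mu>] by metis
  moreover from this have "skein (f_elt n) i ?\<mu> = - f_elt n ?\<mu>" if "?\<mu> \<notin> NC n"
    using that by (simp add: skein_f_elt f_elt_def contract_linear_right)
  ultimately show ?thesis
    using perm_act_F_elt[OF \<pi> assms(2) n] perm_act_f_elt[OF \<pi> assms(2) n] by simp
qed

end
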